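(* Let $m>1$ and let $P_1,\dots,P_m$ be the orthogonal projections of $\mathbb{R}^n$ onto the kernels of real matrices $A_1,\dots,A_m$ with $n$ columns, with column spans $\mathcal{P}_1,\dots,\mathcal{P}_m$, and suppose that $\bigcap_{i=1}^m\mathcal{P}_i=\{0\}$. Let $P=\mathrm{diagonal}\{P_1,\dots,P_m\}$. Let $l$ be a positive integer, let $\mathcal{C}$ be an $l$-compact subset of $m\times m$ stochastic matrices, and define $$\lambda=\Big(\sup_{\mathcal{H}_\omega\in\mathcal{C}_l}\ \sup_{\mathcal{H}_{\omega-1}\in\mathcal{C}_l}\cdots\sup_{\mathcal{H}_1\in\mathcal{C}_l}\big\|P(Q_{\omega l}\otimes I)P(Q_{\omega l-1}\otimes I)\cdots P(Q_1\otimes I)P\big\|\Big)^{\frac1{\omega l}},$$ where $\omega=\frac12(m-1)m$ and, for $i\in\{1,\dots,\omega\}$, $\mathcal{H}_i$ is the subsequence $Q_{(i-1)l+1},Q_{(i-1)l+2},\dots,Q_{il}$. Then $\lambda<1$, and for any infinite sequence of stochastic matrices $S_1,S_2,\dots$ in $\mathcal{C}$ whose graphs form a sequence $\gamma(S_1),\gamma(S_2),\dots$ which is repeatedly jointly strongly connected by contiguous subsequences of length $l$, $$\big\|P(S_t\otimes I)P(S_{t-1}\otimes I)\cdots P(S_1\otimes I)P\big\|\le\lambda^{(t-l\omega)}\qquad\text{for all } t\ge1.$$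
   Context: $I$ is the $n\times n$ identity matrix, $\otimes$ the Kronecker product, and $\mathrm{diagonal}\{P_1,\dots,P_m\}$ is the $mn\times mn$ block diagonal matrix. A stochastic matrix is a nonnegative square matrix with all row sums equal to $1$. The graph $\gamma(M)$ of a nonnegative $m\times m$ matrix $M$ is the directed graph on $\{1,\dots,m\}$ in which $(i,j)$ is an arc (from $i$ to $j$) iff the $ji$th entry of $M$ is nonzero. $\mathcal{G}_{sa}$ is the set of directed graphs on $\{1,\dots,m\}$ with self-arcs at all vertices; so $\gamma(M)\in\mathcal{G}_{sa}$ iff all diagonal entries of $M$ are positive. Mixed matrix norm: for an $m\times m$ block matrix $Q=[Q_{ij}]\in\mathbb{R}^{mn\times mn}$ with blocks $Q_{ij}\in\mathbb{R}^{n\times n}$, $\|Q\|=|\langle Q\rangle|_\infty$, where $\langle Q\rangle$ is the $m\times m$ matrix with entries $|Q_{ij}|_2$ ($|\cdot|_2$ the induced two-norm) and $|\cdot|_\infty$ is the induced infinity norm (maximum row sum). A compact set $\mathcal{C}$ of $m\times m$ stochastic matrices with graphs in $\mathcal{G}_{sa}$ is $l$-compact if the set $\mathcal{C}_l$ of all sequences $S_1,\dots,S_l$ with each $S_i\in\mathcal{C}$ for which $\gamma(S_lS_{l-1}\cdots S_1)$ is strongly connected is nonempty and compact. The composition $\mathbb{G}_q\circ\mathbb{G}_p$ is the graph in which $(i,j)$ is an arc iff for some $k$, $(i,k)$ is an arc of $\mathbb{G}_p$ and $(k,j)$ is an arc of $\mathbb{G}_q$ (so $\gamma(M_2M_1)=\gamma(M_2)\circ\gamma(M_1)$).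 The sequence $\mathbb{G}_1,\mathbb{G}_2,\dots$ is repeatedly jointly strongly connected by contiguous subsequences of length $l$ if for every integer $k\ge0$ the composition $\mathbb{G}_{(k+1)l}\circ\cdots\circ\mathbb{G}_{kl+1}$ is strongly connected. Convention: if $\lambda=0$, then $\lambda^{s}$ is read as $1$ for $s=0$ and as $+\infty$ for $s<0$. *)

theory Defs
  imports
    "HOL-Analysis.Analysis"
    "HOL-Library.Extended_Real"
    "Graph_Theory.Graph_Theory"
begin

(* A matrix with n columns is given by the list of its rows, so that matrices with
   different numbers of rows can occur in one indexed family. *)
definition rows_kernel :: "(real ^ 'n) list \<Rightarrow> (real ^ 'n) set" where
  "rows_kernel A = {x. \<forall>a \<in> set A. a \<bullet> x = 0}"

definition is_orth_projection_onto :: "real ^ 'n ^ 'n \<Rightarrow> (real ^ 'n) set \<Rightarrow> bool" where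
  "is_orth_projection_onto P K \<longleftrightarrow>
     (\<forall>x. P *v x \<in> K \<and> (\<forall>y \<in> K. orthogonal (x - P *v x) y))"

definition column_span :: "real ^ 'n ^ 'n \<Rightarrow> (real ^ 'n) set" where
  "column_span P = span (columns P)"

(* The mn x mn matrices have index type 'm \<times> 'n: the index (i, a) is position a of block i. *)

definition kron :: "real ^ 'c::finite ^ 'b::finite \<Rightarrow> real ^ 'e::finite ^ 'd::finite \<Rightarrow> real ^ ('c \<times> 'e) ^ ('b \<times> 'd)"
    (infixl "\<otimes>\<^sub>K" 75) where
  "A \<otimes>\<^sub>K B = (\<chi> p q. A $ fst p $ fst q * B $ snd p $ snd q)"

definition block :: "real ^ ('m::finite \<times> 'n::finite) ^ ('m \<times> 'n) \<Rightarrow> 'm \<Rightarrow> 'm \<Rightarrow> real ^ 'n ^ 'n" where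
  "block Q i j = (\<chi> a b. Q $ (i, a) $ (j, b))"

definition block_diagonal ::
    "('m::finite \<Rightarrow> real ^ 'n::finite ^ 'n) \<Rightarrow> real ^ ('m \<times> 'n) ^ ('m \<times> 'n)" where
  "block_diagonal P =
     (\<chi> p q. if fst p = fst q then P (fst p) $ snd p $ snd q else 0)"

definition two_norm :: "real ^ 'n ^ 'n \<Rightarrow> real" where
  "two_norm M = onorm (\<lambda>x. M *v x)"

definition inf_norm :: "real ^ 'm ^ 'm \<Rightarrow> real" where
  "inf_norm M = (MAX i \<in> UNIV. \<Sum>j \<in> UNIV. \<bar>M $ i $ j\<bar>)"

definition mixed_norm :: "real ^ ('m::finite \<times> 'n::finite) ^ ('m \<times> 'n) \<Rightarrow> real" where
  "mixed_norm Q = inf_norm (\<chi> i j. two_norm (block Q i j))"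

definition stochastic :: "real ^ 'm ^ 'm \<Rightarrow> bool" where
  "stochastic M \<longleftrightarrow> (\<forall>i j. 0 \<le> M $ i $ j) \<and> (\<forall>i. (\<Sum>j \<in> UNIV. M $ i $ j) = 1)"

(* (i, j) is an arc iff the ji-th entry is nonzero: arcs run from columns to rows. *)
definition matrix_graph :: "real ^ 'm ^ 'm \<Rightarrow> 'm pair_pre_digraph" where
  "matrix_graph M = \<lparr> pverts = UNIV, parcs = {(i, j). M $ j $ i \<noteq> 0} \<rparr>"

definition self_arced_graphs :: "'m pair_pre_digraph set" where
  "self_arced_graphs = {G. pverts G = UNIV \<and> (\<forall>i. (i, i) \<in> parcs G)}"

(* graph_comp Gq Gp follows an arc of Gp first and an arc of Gq second. *)
definition graph_comp ::
    "'m pair_pre_digraph \<Rightarrow> 'm pair_pre_digraph \<Rightarrow> 'm pair_pre_digraph" where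
  "graph_comp Gq Gp =
     \<lparr> pverts = UNIV, parcs = {(i, j). \<exists>k. (i, k) \<in> parcs Gp \<and> (k, j) \<in> parcs Gq} \<rparr>"

(* graph_comp_seq G a l = G (a+l) o ... o G (a+1); the graph with exactly the self-arcs
   is the neutral element of composition. *)
primrec graph_comp_seq ::
    "(nat \<Rightarrow> 'm pair_pre_digraph) \<Rightarrow> nat \<Rightarrow> nat \<Rightarrow> 'm pair_pre_digraph" where
  "graph_comp_seq G a 0 = \<lparr> pverts = UNIV, parcs = Id \<rparr>"
| "graph_comp_seq G a (Suc l) = graph_comp (G (a + Suc l)) (graph_comp_seq G a l)"

definition rep_jointly_strongly_connected ::
    "nat \<Rightarrow> (nat \<Rightarrow> 'm pair_pre_digraph) \<Rightarrow> bool" where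
  "rep_jointly_strongly_connected l G \<longleftrightarrow>
     (\<forall>k. strongly_connected (with_proj (graph_comp_seq G (k * l) l)))"

(* left_product S l = S l ** ... ** S 1 *)
primrec left_product :: "(nat \<Rightarrow> real ^ 'm ^ 'm) \<Rightarrow> nat \<Rightarrow> real ^ 'm ^ 'm" where
  "left_product S 0 = mat 1"
| "left_product S (Suc l) = S (Suc l) ** left_product S l"

(* Sequences S 1, ..., S l are extensional functions on {1..l}. *)
definition sc_sequences :: "(real ^ 'm ^ 'm) set \<Rightarrow> nat \<Rightarrow> (nat \<Rightarrow> real ^ 'm ^ 'm) set" where
  "sc_sequences C l =
     {S \<in> {1..l} \<rightarrow>\<^sub>E C. strongly_connected (with_proj (matrix_graph (left_product S l)))}"

definition l_compact :: "nat \<Rightarrow> (real ^ 'm ^ 'm) set \<Rightarrow> bool" where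
  "l_compact l C \<longleftrightarrow>
     compact C \<and> (\<forall>S \<in> C. stochastic S \<and> matrix_graph S \<in> self_arced_graphs) \<and>
     sc_sequences C l \<noteq> {} \<and>
     compactin (product_topology (\<lambda>_. euclidean) {1..l}) (sc_sequences C l)"

(* proj_product P Q t = P (Q t \<otimes> I) P (Q (t-1) \<otimes> I) ... P (Q 1 \<otimes> I) P,
   with P the block diagonal matrix of the given family *)
primrec proj_product ::
    "('m::finite \<Rightarrow> real ^ 'n::finite ^ 'n) \<Rightarrow> (nat \<Rightarrow> real ^ 'm ^ 'm) \<Rightarrow> nat \<Rightarrow>
     real ^ ('m \<times> 'n) ^ ('m \<times> 'n)" where
  "proj_product P Q 0 = block_diagonal P"
| "proj_product P Q (Suc t) =
     block_diagonal P ** (Q (Suc t) \<otimes>\<^sub>K mat 1) ** proj_product P Q t"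

(* iterated_sup X k F = sup over h_k, then over h_(k-1), ..., then over h_1, all in X,
   of F [h_1, ..., h_k] *)
primrec iterated_sup :: "'a set \<Rightarrow> nat \<Rightarrow> ('a list \<Rightarrow> real) \<Rightarrow> real" where
  "iterated_sup X 0 F = F []"
| "iterated_sup X (Suc k) F = (SUP h \<in> X. iterated_sup X k (\<lambda>hs. F (hs @ [h])))"

(* The sequence, indexed from 1, obtained by joining the sequences in hs, each indexed by
   {1..l}: entry (i-1)l+j of the result is entry j of the i-th member of hs. *)
definition join_sequences :: "nat \<Rightarrow> (nat \<Rightarrow> 'a) list \<Rightarrow> nat \<Rightarrow> 'a" where
  "join_sequences l hs s = (hs ! ((s - 1) div l)) ((s - 1) mod l + 1)"

definition omega :: "'m itself \<Rightarrow> nat" where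
  "omega _ = (CARD('m) - 1) * CARD('m) div 2"

(* Under l_compact, and for orthogonal projections, the real suprema are over nonempty
   sets that are bounded above. *)
definition conv_rate ::
    "('m::finite \<Rightarrow> real ^ 'n::finite ^ 'n) \<Rightarrow> nat \<Rightarrow> (real ^ 'm ^ 'm) set \<Rightarrow> real" where
  "conv_rate P l C =
     (iterated_sup (sc_sequences C l) (omega TYPE('m))
        (\<lambda>hs. mixed_norm (proj_product P (join_sequences l hs) (omega TYPE('m) * l))))
     powr (1 / real (omega TYPE('m) * l))"

(* Integer power with the convention that a negative power of 0 is infinite; 0 powi 0 = 1. *)
definition ext_power :: "real \<Rightarrow> int \<Rightarrow> ereal" where
  "ext_power x s = (if x = 0 \<and> s < 0 then \<infinity> else ereal (x powi s))"

end

theory Submission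
  imports Defs
begin

text \<open>
  The product \<open>P (S\<^sub>t \<otimes> I) P \<cdots> P (S\<^sub>1 \<otimes> I) P\<close> expands along walks: its block in position
  \<open>(i, j)\<close> is a sum over the walks of length \<open>t\<close> from \<open>j\<close> to \<open>i\<close> in the graphs \<open>\<gamma>(S\<^sub>1), \<dots>, \<gamma>(S\<^sub>t)\<close>,
  in which a walk through \<open>v\<^sub>0, \<dots>, v\<^sub>t\<close> contributes the product of the entries along it times
  \<open>P\<^bsub>v t\<^esub> \<cdots> P\<^bsub>v 0\<^esub>\<close>.  Projections do not increase norms, so the two-norm of this block is at most
  the \<open>(i, j)\<close> entry of \<open>S\<^sub>t \<cdots> S\<^sub>1\<close>, and since that product is stochastic all row sums in the mixed
  norm are at most 1.  Equality for one block forces a unit vector on which the block acts without any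
  loss; such a vector is fixed by the projection at every vertex of every walk from \<open>j\<close> to \<open>i\<close>
  (\<open>isometric_block_fixed\<close>).  If one of these walks visits all vertices, the vector lies in all
  ranges of the \<open>P\<^sub>i\<close>, which is impossible; hence row \<open>i\<close> sums to less than 1.

  The number \<open>\<omega> = 1 + 2 + \<cdots> + (m - 1)\<close> of blocks is what a greedy construction of such a walk
  needs (\<open>covering_walk\<close>).  Build the walk backwards from \<open>i\<close>.  Because of the self-arcs and the
  strong connectivity of each block, going back through \<open>r\<close> further blocks leaves a choice of at
  least \<open>r + 1\<close> vertices (\<open>card_walk_sources\<close>); when \<open>r\<close> vertices have been visited so far, one of
  these is new.  Visiting all \<open>m\<close> vertices in this way takes \<open>1 + 2 + \<cdots> + (m - 1)\<close> blocks.

  So every product over \<open>\<omega>\<close> blocks has mixed norm below 1.  This norm depends continuously on the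
  blocks, which range over a compact set, so one bound \<open>c < 1\<close> serves all of them
  (\<open>uniform_contraction\<close>), and the iterated supremum \<open>L = \<lambda>\<^bsup>\<omega>l\<^esup>\<close> is at most \<open>c\<close>.  Finally, as \<open>P\<close> is
  idempotent, a long product splits into consecutive windows of length \<open>\<omega>l\<close>, each of norm at most
  \<open>L\<close>, and a remainder of norm at most 1 (\<open>mixed_norm_windows_le_power\<close>).  With
  \<open>k = t div (\<omega>l)\<close> windows the bound \<open>L\<^sup>k = \<lambda>\<^bsup>k\<omega>l\<^esup>\<close> is at most \<open>\<lambda>\<^bsup>t - \<omega>l\<^esup>\<close> because \<open>k\<omega>l > t - \<omega>l\<close>.
\<close>

section \<open>Orthogonal projections\<close>

lemma subspace_rows_kernel: "subspace (rows_kernel A)"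
  by (auto simp: subspace_def rows_kernel_def inner_add_right)

lemma orth_projection_fixes:
  assumes "is_orth_projection_onto P K" "subspace K" "y \<in> K"
  shows "P *v y = y"
proof -
  have "P *v y \<in> K" and orth: "\<And>z. z \<in> K \<Longrightarrow> orthogonal (y - P *v y) z"
    using assms(1) by (auto simp: is_orth_projection_onto_def)
  then have "y - P *v y \<in> K"
    using assms by (simp add: subspace_diff)
  then have "orthogonal (y - P *v y) (y - P *v y)"
    by (rule orth)
  then show ?thesis
    by (simp add: orthogonal_self)
qed

lemma orth_projection_idempotent:
  assumes "is_orth_projection_onto P K" "subspace K"
  shows "P ** P = P"
proof -
  have "P *v (P *v x) = P *v x" for x
    using assms orth_projection_fixes is_orth_projection_onto_def by blast
  then show ?thesis
    by (simp add: matrix_eq matrix_vector_mul_assoc)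
qed

lemma orth_projection_Pythagoras:
  assumes "is_orth_projection_onto P K"
  shows "(norm x)\<^sup>2 = (norm (P *v x))\<^sup>2 + (norm (x - P *v x))\<^sup>2"
proof -
  have "orthogonal (P *v x) (x - P *v x)"
    using assms by (simp add: is_orth_projection_onto_def orthogonal_commute)
  from norm_add_Pythagorean[OF this] show ?thesis by simp
qed

lemma orth_projection_norm_le:
  assumes "is_orth_projection_onto P K"
  shows "norm (P *v x) \<le> norm x"
  using orth_projection_Pythagoras[OF assms, of x]
  by (simp add: power2_le_imp_le)

text \<open>This is the source of strictness: a projection that loses no length moves nothing.\<close>

lemma orth_projection_norm_eq_imp_fixed:
  assumes "is_orth_projection_onto P K" "norm (P *v x) = norm x"
  shows "P *v x = x"
  using orth_projection_Pythagoras[OF assms(1), of x] assms(2) by simp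

section \<open>The induced two-norm and the mixed norm\<close>

lemma two_norm_ge_0: "0 \<le> two_norm M"
  unfolding two_norm_def by (intro onorm_pos_le matrix_vector_mul_bounded_linear)

lemma norm_matrix_vector_le: "norm (M *v x) \<le> two_norm M * norm x"
  unfolding two_norm_def by (intro onorm matrix_vector_mul_bounded_linear)

lemma two_norm_le:
  assumes "\<And>x. norm (M *v x) \<le> c * norm x"
  shows "two_norm M \<le> c"
  unfolding two_norm_def using assms by (rule onorm_le)

lemma two_norm_add: "two_norm (M + N) \<le> two_norm M + two_norm N"
proof (rule two_norm_le)
  fix x :: "real ^ 'a"
  have "norm ((M + N) *v x) \<le> norm (M *v x) + norm (N *v x)"
    by (simp add: matrix_vector_mult_add_rdistrib norm_triangle_ineq)
  also have "\<dots> \<le> (two_norm M + two_norm N) * norm x"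
    using norm_matrix_vector_le[of M x] norm_matrix_vector_le[of N x]
    by (simp add: distrib_right)
  finally show "norm ((M + N) *v x) \<le> (two_norm M + two_norm N) * norm x" .
qed

lemma matrix_vector_mult_sum_left:
  fixes f :: "'k \<Rightarrow> real ^ 'n ^ 'm"
  shows "(\<Sum>k\<in>K. f k) *v x = (\<Sum>k\<in>K. f k *v x)"
  by (induction K rule: infinite_finite_induct)
    (auto simp: matrix_vector_mult_add_rdistrib)

lemma two_norm_sum_mult:
  "two_norm (\<Sum>k\<in>K. M k ** N k) \<le> (\<Sum>k\<in>K. two_norm (M k) * two_norm (N k))"
proof (rule two_norm_le)
  fix x :: "real ^ 'a"
  have "norm ((\<Sum>k\<in>K. M k ** N k) *v x) \<le> (\<Sum>k\<in>K. norm ((M k ** N k) *v x))"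
    by (simp add: matrix_vector_mult_sum_left norm_sum)
  also have "\<dots> \<le> (\<Sum>k\<in>K. two_norm (M k) * two_norm (N k) * norm x)"
  proof (rule sum_mono)
    fix k
    have "norm ((M k ** N k) *v x) \<le> two_norm (M k) * norm (N k *v x)"
      by (metis matrix_vector_mul_assoc norm_matrix_vector_le)
    also have "\<dots> \<le> two_norm (M k) * (two_norm (N k) * norm x)"
      by (intro mult_left_mono norm_matrix_vector_le two_norm_ge_0)
    finally show "norm ((M k ** N k) *v x) \<le> two_norm (M k) * two_norm (N k) * norm x"
      by (simp add: mult.assoc)
  qed
  finally show "norm ((\<Sum>k\<in>K. M k ** N k) *v x) \<le> (\<Sum>k\<in>K. two_norm (M k) * two_norm (N k)) * norm x"
    by (simp add: sum_distrib_right)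
qed

lemma two_norm_attained:
  fixes M :: "real ^ 'n ^ 'n"
  obtains x where "norm x = 1" "norm (M *v x) = two_norm M"
proof -
  let ?U = "sphere (0 :: real ^ 'n) 1"
  have "continuous_on ?U (\<lambda>x. norm (M *v x))"
    by (intro continuous_intros linear_continuous_on matrix_vector_mul_bounded_linear)
  moreover have "?U \<noteq> {}"
    by (simp add: sphere_eq_empty)
  ultimately obtain x where x: "norm x = 1"
    and max: "\<And>y. norm y = 1 \<Longrightarrow> norm (M *v y) \<le> norm (M *v x)"
    using continuous_attains_sup[of ?U "\<lambda>x. norm (M *v x)"] by (auto simp: dist_norm)
  have "two_norm M \<le> norm (M *v x)"
  proof (rule two_norm_le)
    fix y
    show "norm (M *v y) \<le> norm (M *v x) * norm y"
    proof (cases "y = 0")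
      case False
      have "norm (M *v y) = norm y * norm (M *v ((1 / norm y) *\<^sub>R y))"
        using False by (simp add: matrix_vector_mult_scaleR)
      also have "\<dots> \<le> norm y * norm (M *v x)"
        using False by (intro mult_left_mono max) auto
      finally show ?thesis by (simp add: mult.commute)
    qed simp
  qed
  moreover have "norm (M *v x) \<le> two_norm M"
    using norm_matrix_vector_le[of M x] x by simp
  ultimately show ?thesis using that x by simp
qed

text \<open>The two-norm is Lipschitz with respect to the sum of the absolute values of the entries, by the
  triangle inequality.\<close>

lemma tendsto_two_norm [tendsto_intros]:
  fixes M :: "real ^ 'n ^ 'n"
  assumes "(f \<longlongrightarrow> M) F"
  shows "((\<lambda>x. two_norm (f x)) \<longlongrightarrow> two_norm M) F"
proof -
  have diff: "\<bar>two_norm A - two_norm B\<bar> \<le> (\<Sum>i\<in>UNIV. \<Sum>j\<in>UNIV. \<bar>(A - B) $ i $ j\<bar>)"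
    for A B :: "real ^ 'n ^ 'n"
  proof -
    have "two_norm A \<le> two_norm B + two_norm (A - B)"
      using two_norm_add[of B "A - B"] by simp
    moreover have "two_norm B \<le> two_norm A + two_norm (B - A)"
      using two_norm_add[of A "B - A"] by simp
    moreover have "two_norm (A - B) \<le> (\<Sum>i\<in>UNIV. \<Sum>j\<in>UNIV. \<bar>(A - B) $ i $ j\<bar>)"
      "two_norm (B - A) \<le> (\<Sum>i\<in>UNIV. \<Sum>j\<in>UNIV. \<bar>(B - A) $ i $ j\<bar>)"
      unfolding two_norm_def by (rule onorm_le_matrix_component_sum)+
    ultimately show ?thesis
      by (simp add: abs_minus_commute abs_le_iff)
  qed
  let ?d = "\<lambda>x. \<Sum>i\<in>UNIV. \<Sum>j\<in>UNIV. \<bar>(f x - M) $ i $ j\<bar>"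
  have "(?d \<longlongrightarrow> (\<Sum>i\<in>UNIV. \<Sum>j\<in>UNIV. \<bar>(M - M) $ i $ j\<bar>)) F"
    by (intro tendsto_intros assms)
  then have "(?d \<longlongrightarrow> 0) F"
    by simp
  moreover have "\<forall>x. norm (two_norm (f x) - two_norm M) \<le> ?d x"
    using diff by simp
  ultimately have "((\<lambda>x. two_norm (f x) - two_norm M) \<longlongrightarrow> 0) F"
    by (rule Lim_null_comparison[OF always_eventually, rotated])
  then show ?thesis
    by (rule LIM_zero_cancel)
qed

lemma mixed_norm_eq:
  "mixed_norm Q = (MAX i. \<Sum>j\<in>UNIV. two_norm (block Q i j))"
  by (simp add: mixed_norm_def inf_norm_def two_norm_ge_0)

lemma row_sum_le_mixed_norm: "(\<Sum>j\<in>UNIV. two_norm (block Q i j)) \<le> mixed_norm Q"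
  unfolding mixed_norm_eq by (intro Max_ge) auto

lemma mixed_norm_le_iff:
  "mixed_norm Q \<le> c \<longleftrightarrow> (\<forall>i. (\<Sum>j\<in>UNIV. two_norm (block Q i j)) \<le> c)"
  unfolding mixed_norm_eq by (subst Max_le_iff) auto

lemma mixed_norm_less_iff:
  "mixed_norm Q < c \<longleftrightarrow> (\<forall>i. (\<Sum>j\<in>UNIV. two_norm (block Q i j)) < c)"
  unfolding mixed_norm_eq by (subst Max_less_iff) auto

lemma mixed_norm_ge_0: "0 \<le> mixed_norm Q"
  using row_sum_le_mixed_norm[of Q undefined]
  by (meson order_trans sum_nonneg two_norm_ge_0)

lemma block_mult: "block (Q ** R) i j = (\<Sum>k\<in>UNIV. block Q i k ** block R k j)"
proof -
  have "(\<Sum>p\<in>UNIV. Q $ (i, a) $ p * R $ p $ (j, b)) =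
      (\<Sum>k\<in>UNIV. \<Sum>c\<in>UNIV. Q $ (i, a) $ (k, c) * R $ (k, c) $ (j, b))" for a b
    by (subst sum.cartesian_product) (simp add: case_prod_beta)
  then show ?thesis
    by (simp add: block_def matrix_matrix_mult_def vec_eq_iff)
qed

text \<open>The two-norm is submultiplicative on blocks, and so is the maximum row sum on the nonnegative
  matrices of block norms.\<close>

lemma mixed_norm_mult: "mixed_norm (Q ** R) \<le> mixed_norm Q * mixed_norm R"
  unfolding mixed_norm_le_iff
proof
  fix i
  have "(\<Sum>j\<in>UNIV. two_norm (block (Q ** R) i j)) \<le>
      (\<Sum>j\<in>UNIV. \<Sum>k\<in>UNIV. two_norm (block Q i k) * two_norm (block R k j))"
    unfolding block_mult by (intro sum_mono two_norm_sum_mult)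
  also have "\<dots> = (\<Sum>k\<in>UNIV. two_norm (block Q i k) * (\<Sum>j\<in>UNIV. two_norm (block R k j)))"
    by (subst sum.swap) (simp add: sum_distrib_left)
  also have "\<dots> \<le> (\<Sum>k\<in>UNIV. two_norm (block Q i k) * mixed_norm R)"
    by (intro sum_mono mult_left_mono row_sum_le_mixed_norm two_norm_ge_0)
  also have "\<dots> \<le> mixed_norm Q * mixed_norm R"
    unfolding sum_distrib_right[symmetric]
    by (intro mult_right_mono row_sum_le_mixed_norm mixed_norm_ge_0)
  finally show "(\<Sum>j\<in>UNIV. two_norm (block (Q ** R) i j)) \<le> mixed_norm Q * mixed_norm R" .
qed

lemma block_eqI: "(\<And>i j. block Q i j = block R i j) \<Longrightarrow> Q = R"
  by (simp add: block_def vec_eq_iff)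

section \<open>Blocks of the projected products\<close>

lemma block_block_diagonal: "block (block_diagonal P) i j = (if i = j then P i else 0)"
  by (simp add: block_def block_diagonal_def vec_eq_iff)

lemma block_kron_mat_1: "block (M \<otimes>\<^sub>K mat 1) i j = M $ i $ j *\<^sub>R mat 1"
  by (simp add: block_def kron_def vec_eq_iff mat_def)

lemma block_proj_product_0:
  "block (proj_product P Q 0) i j *v x = (if i = j then P i *v x else 0)"
  by (simp add: block_block_diagonal)

text \<open>The recursion behind the expansion along walks: the last step of a walk into \<open>i\<close> comes from some
  vertex \<open>k\<close>, weighted by the entry \<open>(i, k)\<close>.\<close>

lemma block_proj_product_Suc:
  "block (proj_product P Q (Suc t)) i j *v x =
    P i *v (\<Sum>k\<in>UNIV. Q (Suc t) $ i $ k *\<^sub>R (block (proj_product P Q t) k j *v x))"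
proof -
  have step: "block (block_diagonal P ** (Q (Suc t) \<otimes>\<^sub>K mat 1)) i k *v y =
      P i *v (Q (Suc t) $ i $ k *\<^sub>R y)" for k y
  proof -
    have "block (block_diagonal P ** (Q (Suc t) \<otimes>\<^sub>K mat 1)) i k =
        (\<Sum>h\<in>UNIV. if i = h then P i ** (Q (Suc t) $ i $ k *\<^sub>R mat 1) else 0)"
      unfolding block_mult block_block_diagonal block_kron_mat_1
      by (intro sum.cong) auto
    then show ?thesis
      by (simp add: matrix_vector_mul_assoc[symmetric] scaleR_matrix_vector_assoc[symmetric])
  qed
  have "block (proj_product P Q (Suc t)) i j *v x =
      (\<Sum>k\<in>UNIV. block (block_diagonal P ** (Q (Suc t) \<otimes>\<^sub>K mat 1)) i k *v
        (block (proj_product P Q t) k j *v x))"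
    by (simp add: block_mult matrix_vector_mult_sum_left matrix_vector_mul_assoc)
  also have "\<dots> = P i *v (\<Sum>k\<in>UNIV. Q (Suc t) $ i $ k *\<^sub>R (block (proj_product P Q t) k j *v x))"
    unfolding step by (simp add: linear_sum)
  finally show ?thesis .
qed

lemma left_product_nonneg:
  assumes "\<And>s. s \<in> {1..t} \<Longrightarrow> stochastic (Q s)"
  shows "0 \<le> left_product Q t $ i $ j"
  using assms
proof (induction t arbitrary: i)
  case (Suc t)
  then have "0 \<le> left_product Q t $ k $ j" "0 \<le> Q (Suc t) $ i $ k" for k
    by (auto simp: stochastic_def)
  then show ?case
    by (simp add: matrix_matrix_mult_def sum_nonneg)
qed (simp add: mat_def)

lemma left_product_row_sum:
  assumes "\<And>s. s \<in> {1..t} \<Longrightarrow> stochastic (Q s)"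
  shows "(\<Sum>j\<in>UNIV. left_product Q t $ i $ j) = 1"
  using assms
proof (induction t arbitrary: i)
  case (Suc t)
  have "(\<Sum>j\<in>UNIV. left_product Q (Suc t) $ i $ j) =
      (\<Sum>k\<in>UNIV. Q (Suc t) $ i $ k * (\<Sum>j\<in>UNIV. left_product Q t $ k $ j))"
    by (simp add: matrix_matrix_mult_def sum_distrib_left) (rule sum.swap)
  also have "\<dots> = (\<Sum>k\<in>UNIV. Q (Suc t) $ i $ k)"
    using Suc by simp
  also have "\<dots> = 1"
    using Suc.prems by (simp add: stochastic_def)
  finally show ?case .
qed (simp add: mat_def)

text \<open>Replacing every projection by the identity would turn the block into the scalar matrix of the
  entry of \<open>left_product Q t\<close>, and projections only shorten vectors.\<close>

lemma norm_block_proj_product_le: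
  assumes proj: "\<And>i. is_orth_projection_onto (P i) (K i)"
    and stoch: "\<And>s. s \<in> {1..t} \<Longrightarrow> stochastic (Q s)"
  shows "norm (block (proj_product P Q t) i j *v x) \<le> left_product Q t $ i $ j * norm x"
  using stoch
proof (induction t arbitrary: i)
  case 0
  show ?case
    unfolding block_proj_product_0
    using orth_projection_norm_le[OF proj] by (simp add: mat_def)
next
  case (Suc t)
  let ?B = "\<lambda>k. block (proj_product P Q t) k j *v x"
  have nonneg: "0 \<le> Q (Suc t) $ i $ k" for k
    using Suc.prems by (auto simp: stochastic_def)
  have "norm (block (proj_product P Q (Suc t)) i j *v x) \<le>
      norm (\<Sum>k\<in>UNIV. Q (Suc t) $ i $ k *\<^sub>R ?B k)"
    unfolding block_proj_product_Suc by (rule orth_projection_norm_le[OF proj])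
  also have "\<dots> \<le> (\<Sum>k\<in>UNIV. norm (Q (Suc t) $ i $ k *\<^sub>R ?B k))"
    by (rule norm_sum)
  also have "\<dots> \<le> (\<Sum>k\<in>UNIV. Q (Suc t) $ i $ k * (left_product Q t $ k $ j * norm x))"
    using nonneg Suc by (intro sum_mono) (auto intro!: mult_left_mono)
  also have "\<dots> = left_product Q (Suc t) $ i $ j * norm x"
    by (simp add: matrix_matrix_mult_def sum_distrib_right mult.assoc)
  finally show ?case .
qed

lemma two_norm_block_proj_product_le:
  assumes "\<And>i. is_orth_projection_onto (P i) (K i)"
    and "\<And>s. s \<in> {1..t} \<Longrightarrow> stochastic (Q s)"
  shows "two_norm (block (proj_product P Q t) i j) \<le> left_product Q t $ i $ j"
  by (intro two_norm_le norm_block_proj_product_le[OF assms])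

lemma mixed_norm_proj_product_le_1:
  assumes "\<And>i. is_orth_projection_onto (P i) (K i)"
    and "\<And>s. s \<in> {1..t} \<Longrightarrow> stochastic (Q s)"
  shows "mixed_norm (proj_product P Q t) \<le> 1"
  unfolding mixed_norm_le_iff
proof
  fix i
  have "(\<Sum>j\<in>UNIV. two_norm (block (proj_product P Q t) i j)) \<le> (\<Sum>j\<in>UNIV. left_product Q t $ i $ j)"
    by (intro sum_mono two_norm_block_proj_product_le[OF assms])
  also have "\<dots> = 1"
    using assms(2) by (rule left_product_row_sum)
  finally show "(\<Sum>j\<in>UNIV. two_norm (block (proj_product P Q t) i j)) \<le> 1" .
qed

text \<open>Both factors carry a \<open>P\<close> at the seam; idempotence merges them into the single one of the
  whole product.\<close>

lemma proj_product_add: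
  assumes "\<And>i. P i ** P i = P i"
  shows "proj_product P Q (a + b) = proj_product P (\<lambda>s. Q (a + s)) b ** proj_product P Q a"
proof (induction b)
  case 0
  have "block_diagonal P ** block_diagonal P = block_diagonal P"
  proof (rule block_eqI)
    fix i j
    have "block (block_diagonal P ** block_diagonal P) i j =
        (\<Sum>k\<in>UNIV. if i = k then (if i = j then P i else 0) else 0)"
      unfolding block_mult block_block_diagonal using assms by (intro sum.cong) auto
    then show "block (block_diagonal P ** block_diagonal P) i j = block (block_diagonal P) i j"
      by (simp add: block_block_diagonal)
  qed
  then show ?case
    by (cases a) (simp_all add: matrix_mul_assoc)
qed (simp add: matrix_mul_assoc)

lemma proj_product_cong:
  assumes "\<And>s. s \<in> {1..t} \<Longrightarrow> Q s = R s"
  shows "proj_product P Q t = proj_product P R t"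
  using assms by (induction t) auto

lemma left_product_cong:
  assumes "\<And>s. s \<in> {1..t} \<Longrightarrow> Q s = R s"
  shows "left_product Q t = left_product R t"
  using assms by (induction t) auto

section \<open>Walks in a sequence of graphs\<close>

text \<open>The vertex of a walk at time \<open>s\<close> is \<open>v s\<close>, and graph \<open>G s\<close> governs the step from time \<open>s - 1\<close> to
  time \<open>s\<close>.  Values of \<open>v\<close> outside \<open>{a..b}\<close> are unconstrained, so walks over adjacent time intervals
  can be glued as functions.\<close>

definition walk :: "(nat \<Rightarrow> 'm pair_pre_digraph) \<Rightarrow> nat \<Rightarrow> nat \<Rightarrow> (nat \<Rightarrow> 'm) \<Rightarrow> bool" where
  "walk G a b v \<longleftrightarrow> (\<forall>s \<in> {a<..b}. (v (s - 1), v s) \<in> parcs (G s))"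

lemma walk_append:
  assumes "walk G a b v" "walk G b c w" "v b = w b"
  shows "walk G a c (\<lambda>s. if s < b then v s else w s)"
  unfolding walk_def
proof
  fix s assume s: "s \<in> {a<..c}"
  consider "s < b" | "s = b" | "s > b" by linarith
  then show "(if s - 1 < b then v (s - 1) else w (s - 1), if s < b then v s else w s) \<in> parcs (G s)"
  proof cases
    case 1
    then show ?thesis using assms(1) s by (auto simp: walk_def)
  next
    case 2
    then show ?thesis using assms(1) s assms(3)[symmetric] by (auto simp: walk_def)
  next
    case 3
    then show ?thesis using assms(2) s by (auto simp: walk_def)
  qed
qed

lemma parcs_graph_comp_seq:
  "(u, w) \<in> parcs (graph_comp_seq G a t) \<longleftrightarrow> (\<exists>v. walk G a (a + t) v \<and> v a = u \<and> v (a + t) = w)"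
proof (induction t arbitrary: w)
  case 0
  then show ?case by (auto simp: walk_def)
next
  case (Suc t)
  show ?case
  proof
    assume "(u, w) \<in> parcs (graph_comp_seq G a (Suc t))"
    then obtain k where "(u, k) \<in> parcs (graph_comp_seq G a t)" and k: "(k, w) \<in> parcs (G (a + Suc t))"
      by (auto simp: graph_comp_def)
    then obtain v where v: "walk G a (a + t) v" "v a = u" "v (a + t) = k"
      using Suc by blast
    then have "walk G a (a + Suc t) (v(a + Suc t := w))"
      using k by (auto simp: walk_def le_Suc_eq)
    then show "\<exists>v. walk G a (a + Suc t) v \<and> v a = u \<and> v (a + Suc t) = w"
      using v by (intro exI[of _ "v(a + Suc t := w)"]) auto
  next
    assume "\<exists>v. walk G a (a + Suc t) v \<and> v a = u \<and> v (a + Suc t) = w"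
    then obtain v where v: "walk G a (a + Suc t) v" "v a = u" "v (a + Suc t) = w"
      by blast
    then have "walk G a (a + t) v" "(v (a + t), w) \<in> parcs (G (a + Suc t))"
      by (auto simp: walk_def dest!: bspec[of _ _ "Suc (a + t)"])
    then have "(u, v (a + t)) \<in> parcs (graph_comp_seq G a t)"
      using Suc v(2) by blast
    with \<open>(v (a + t), w) \<in> _\<close> show "(u, w) \<in> parcs (graph_comp_seq G a (Suc t))"
      by (auto simp: graph_comp_def)
  qed
qed

lemma graph_comp_seq_shift: "graph_comp_seq (\<lambda>s. G (c + s)) a t = graph_comp_seq G (c + a) t"
  by (induction t) (simp_all add: add.assoc)

lemma graph_comp_seq_self_arc:
  assumes "\<And>s. s \<in> {a<..a + t} \<Longrightarrow> (i, i) \<in> parcs (G s)"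
  shows "(i, i) \<in> parcs (graph_comp_seq G a t)"
  unfolding parcs_graph_comp_seq using assms by (intro exI[of _ "\<lambda>_. i"]) (simp add: walk_def)

text \<open>Nonnegative entries cannot cancel, so an entry of a product is nonzero as soon as one term
  is.\<close>

lemma matrix_graph_left_product:
  assumes "\<And>s. s \<in> {1..t} \<Longrightarrow> stochastic (Q s)"
  shows "matrix_graph (left_product Q t) = graph_comp_seq (\<lambda>s. matrix_graph (Q s)) 0 t"
  using assms
proof (induction t)
  case 0
  show ?case by (auto simp: matrix_graph_def mat_def)
next
  case (Suc t)
  have nonneg: "0 \<le> Q (Suc t) $ j $ k" "0 \<le> left_product Q t $ k $ i" for i j k
    using Suc.prems left_product_nonneg[of t Q] by (auto simp: stochastic_def)
  have "left_product Q (Suc t) $ j $ i \<noteq> 0 \<longleftrightarrow>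
      (\<exists>k. left_product Q t $ k $ i \<noteq> 0 \<and> Q (Suc t) $ j $ k \<noteq> 0)" for i j
    using nonneg by (auto simp: matrix_matrix_mult_def sum_nonneg_eq_0_iff)
  moreover have "graph_comp_seq (\<lambda>s. matrix_graph (Q s)) 0 t = matrix_graph (left_product Q t)"
    using Suc by simp
  ultimately show ?case
    by (simp add: graph_comp_def matrix_graph_def)
qed

lemma left_product_walk_pos:
  assumes "\<And>s. s \<in> {1..t} \<Longrightarrow> stochastic (Q s)"
    and "walk (\<lambda>s. matrix_graph (Q s)) 0 t v"
  shows "0 < left_product Q t $ v t $ v 0"
proof -
  have "(v 0, v t) \<in> parcs (graph_comp_seq (\<lambda>s. matrix_graph (Q s)) 0 t)"
    unfolding parcs_graph_comp_seq using assms(2) by auto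
  then have "(v 0, v t) \<in> parcs (matrix_graph (left_product Q t))"
    by (subst matrix_graph_left_product[OF assms(1)])
  then have "left_product Q t $ v t $ v 0 \<noteq> 0"
    by (simp add: matrix_graph_def)
  then show ?thesis
    using left_product_nonneg[OF assms(1)] by (simp add: order_less_le)
qed

lemma strongly_connected_enters:
  assumes "strongly_connected (with_proj G)" "pverts G = UNIV" "w \<in> U" "U \<noteq> UNIV"
  obtains u v where "u \<notin> U" "v \<in> U" "(u, v) \<in> parcs G"
proof -
  obtain u0 where "u0 \<notin> U" using assms(4) by blast
  have "(u0, w) \<in> (parcs G)\<^sup>*"
    using assms(1,2) reachable_rtranclI[of "with_proj G" u0 w] by (simp add: strongly_connected_def)
  then have "\<exists>u v. u \<notin> U \<and> v \<in> U \<and> (u, v) \<in> parcs G"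
    using \<open>u0 \<notin> U\<close> \<open>w \<in> U\<close> by (induction rule: converse_rtrancl_induct) blast+
  then show ?thesis using that by blast
qed

lemma pverts_graph_comp_seq [simp]: "pverts (graph_comp_seq G a t) = UNIV"
  by (cases t) (simp_all add: graph_comp_def)

definition walk_sources :: "(nat \<Rightarrow> 'm pair_pre_digraph) \<Rightarrow> nat \<Rightarrow> nat \<Rightarrow> 'm \<Rightarrow> 'm set" where
  "walk_sources G a b i = {v a |v. walk G a b v \<and> v b = i}"

text \<open>Going back one block, the self-arcs keep all sources, and strong connectivity supplies an arc
  that enters the set of sources from outside, unless the set is already everything.\<close>

lemma card_walk_sources:
  fixes G :: "nat \<Rightarrow> 'm::finite pair_pre_digraph"
  assumes self: "\<And>s j. s \<in> {1..N * l} \<Longrightarrow> (j, j) \<in> parcs (G s)"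
    and conn: "\<And>k. k < N \<Longrightarrow> strongly_connected (with_proj (graph_comp_seq G (k * l) l))"
    and "b + r \<le> N"
  shows "min (Suc r) CARD('m) \<le> card (walk_sources G (b * l) ((b + r) * l) i)"
  using \<open>b + r \<le> N\<close>
proof (induction r arbitrary: b)
  case 0
  have "walk_sources G (b * l) ((b + 0) * l) i = {i}"
    by (auto simp: walk_sources_def walk_def)
  then show ?case by simp
next
  case (Suc r)
  let ?H = "graph_comp_seq G (b * l) l"
  let ?R = "walk_sources G (b * l) ((b + Suc r) * l) i"
  let ?R' = "walk_sources G (Suc b * l) ((Suc b + r) * l) i"
  have step: "u \<in> ?R" if arc: "(u, w) \<in> parcs ?H" and source: "w \<in> ?R'" for u w
  proof -
    obtain v' where v': "walk G (Suc b * l) ((b + Suc r) * l) v'" "v' ((b + Suc r) * l) = i"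
      "v' (Suc b * l) = w"
      using source by (auto simp: walk_sources_def)
    obtain v where v: "walk G (b * l) (Suc b * l) v" "v (b * l) = u" "v (Suc b * l) = w"
      using arc by (auto simp: parcs_graph_comp_seq add.commute)
    let ?w = "\<lambda>s. if s < Suc b * l then v s else v' s"
    have "walk G (b * l) ((b + Suc r) * l) ?w"
      using walk_append[OF v(1) v'(1)] v(3) v'(3) by simp
    moreover have "?w (b * l) = u"
      using v v' by (cases "l = 0") auto
    moreover have "?w ((b + Suc r) * l) = i"
      using v'(2) by (simp add: not_less)
    ultimately show ?thesis
      unfolding walk_sources_def mem_Collect_eq by (intro exI[of _ ?w] conjI) auto
  qed
  have "(u, u) \<in> parcs ?H" for u
  proof (rule graph_comp_seq_self_arc, rule self)
    fix s assume "s \<in> {b * l<..b * l + l}"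
    moreover have "b * l + l \<le> N * l"
      using mult_le_mono1[of "Suc b" N l] Suc.prems by simp
    ultimately show "s \<in> {1..N * l}" by auto
  qed
  then have sub: "?R' \<subseteq> ?R"
    using step by blast
  have card': "min (Suc r) CARD('m) \<le> card ?R'"
    using Suc.IH[of "Suc b"] Suc.prems by simp
  show ?case
  proof (cases "?R' = UNIV")
    case True
    then have "?R = UNIV" using sub by blast
    then show ?thesis by simp
  next
    case False
    have "0 < min (Suc r) CARD('m)"
      by simp
    then have "0 < card ?R'"
      using card' by (rule less_le_trans)
    then have "?R' \<noteq> {}"
      by (metis card.empty less_irrefl)
    then obtain u w where "u \<notin> ?R'" "w \<in> ?R'" "(u, w) \<in> parcs ?H"
      using strongly_connected_enters[of ?H _ ?R'] conn[of b] Suc.prems False by auto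
    then have "?R' \<subset> ?R"
      using step sub by blast
    then have "card ?R' < card ?R"
      by (intro psubset_card_mono) auto
    then show ?thesis using card' by simp
  qed
qed

text \<open>The walk is extended backwards.  Once it visits more than \<open>r\<close> vertices, \<open>r + 1\<close> further blocks in
  front of it offer at least \<open>r + 2\<close> possible starting vertices, so either more than \<open>r + 1\<close> vertices
  are visited already or one of the possible starts is new.\<close>

lemma covering_walk:
  fixes G :: "nat \<Rightarrow> 'm::finite pair_pre_digraph"
  assumes self: "\<And>s j. s \<in> {1..N * l} \<Longrightarrow> (j, j) \<in> parcs (G s)"
    and conn: "\<And>k. k < N \<Longrightarrow> strongly_connected (with_proj (graph_comp_seq G (k * l) l))"
    and "b + \<Sum>{0..r} \<le> N" "r < CARD('m)"
  shows "\<exists>v. walk G (b * l) ((b + \<Sum>{0..r}) * l) v \<and> v ((b + \<Sum>{0..r}) * l) = i \<and>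
    r < card (v ` {b * l..(b + \<Sum>{0..r}) * l})"
  using \<open>b + _ \<le> N\<close> \<open>r < _\<close>
proof (induction r arbitrary: b)
  case 0
  show ?case
    by (intro exI[of _ "\<lambda>_. i"]) (simp add: walk_def)
next
  case (Suc r)
  define c where "c = b + Suc r"
  define e where "e = (c + \<Sum>{0..r}) * l"
  have e: "(b + \<Sum>{0..Suc r}) * l = e"
    by (simp add: c_def e_def)
  have "c + \<Sum>{0..r} \<le> N"
    using Suc.prems by (simp add: c_def)
  then obtain v where v: "walk G (c * l) e v" "v e = i" "r < card (v ` {c * l..e})"
    unfolding e_def using Suc.IH[of c] Suc.prems by auto
  let ?V = "v ` {c * l..e}"
  let ?R = "walk_sources G (b * l) (c * l) (v (c * l))"
  have R: "Suc r < card ?R"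
  proof -
    have "min (Suc (Suc r)) CARD('m) \<le> card ?R"
      unfolding c_def
    proof (rule card_walk_sources[where N = N])
      show "b + Suc r \<le> N"
        using Suc.prems by simp
    qed (fact self, fact conn)
    then show ?thesis using Suc.prems by simp
  qed
  obtain u where u: "u \<in> ?R" "Suc r < card (insert u ?V)"
  proof (cases "Suc r < card ?V")
    case True
    moreover have "?R \<noteq> {}"
      using R by (metis card.empty not_less_zero)
    moreover have "card ?V \<le> card (insert u ?V)" for u
      by (intro card_mono) auto
    ultimately show ?thesis
      using that less_le_trans by blast
  next
    case False
    then have "\<not> ?R \<subseteq> ?V"
      using R card_mono[of ?V ?R] by auto
    then obtain u where "u \<in> ?R" "u \<notin> ?V" by blast
    then show ?thesis using that v(3) by simp
  qed
  obtain v' where v': "walk G (b * l) (c * l) v'" "v' (b * l) = u" "v' (c * l) = v (c * l)"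
    using u(1) by (auto simp: walk_sources_def)
  let ?w = "\<lambda>s. if s < c * l then v' s else v s"
  have le: "b * l \<le> c * l" "c * l \<le> e"
    unfolding c_def e_def by (intro mult_le_mono1; simp)+
  have "walk G (b * l) e ?w"
    by (rule walk_append[OF v'(1) v(1) v'(3)])
  moreover have "?w e = i"
    using v(2) le by simp
  moreover have "insert u ?V \<subseteq> ?w ` {b * l..e}"
  proof -
    have "?w (b * l) = u"
      using v' le by (cases "b * l < c * l") auto
    moreover have "b * l \<in> {b * l..e}"
      using order_trans[OF le] by simp
    ultimately have "u \<in> ?w ` {b * l..e}"
      by (intro image_eqI[of _ _ "b * l"]) auto
    moreover have "?V \<subseteq> ?w ` {b * l..e}"
    proof
      fix y assume "y \<in> ?V"
      then obtain s where s: "s \<in> {c * l..e}" "y = v s" by blast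
      then have "s \<in> {b * l..e}"
        using order_trans[OF le(1)] by simp
      with s show "y \<in> ?w ` {b * l..e}"
        by (intro image_eqI[of _ _ s]) auto
    qed
    ultimately show ?thesis by blast
  qed
  then have "card (insert u ?V) \<le> card (?w ` {b * l..e})"
    by (intro card_mono) auto
  then have "Suc r < card (?w ` {b * l..e})"
    using u(2) by (rule less_le_trans[rotated])
  ultimately show ?case
    unfolding e by (intro exI[of _ ?w] conjI)
qed

section \<open>Strict contraction over a window of jointly strongly connected blocks\<close>

text \<open>If the block \<open>(i, j)\<close> attains its bound at \<open>x\<close>, all inequalities behind the bound are
  equalities: each preceding block with positive weight attains its bound at \<open>x\<close> too, hence maps
  \<open>x\<close> to its weight times \<open>x\<close>, and the last projection fixes the resulting multiple of \<open>x\<close>.  That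
  multiple is positive as soon as some walk leads from \<open>j\<close> to \<open>i\<close>.\<close>

lemma isometric_block_fixed:
  assumes proj: "\<And>i. is_orth_projection_onto (P i) (K i)"
    and stoch: "\<And>s. s \<in> {1..t} \<Longrightarrow> stochastic (Q s)"
    and isometric: "norm (block (proj_product P Q t) i j *v x) = left_product Q t $ i $ j * norm x"
    and walk: "walk (\<lambda>s. matrix_graph (Q s)) 0 t v" "v 0 = j" "v t = i"
    and "s \<le> t"
  shows "P (v s) *v x = x"
proof -
  \<comment> \<open>The induction has to carry along that the block acts on \<open>x\<close> as the scalar weight, and to range
    over all walks, since it descends to every vertex \<open>k\<close> preceding \<open>i\<close>.\<close>
  have "block (proj_product P Q t) i j *v x = left_product Q t $ i $ j *\<^sub>R x \<and>
    (\<forall>v s. walk (\<lambda>s. matrix_graph (Q s)) 0 t v \<longrightarrow> v 0 = j \<longrightarrow> v t = i \<longrightarrow> s \<le> t \<longrightarrow>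
      P (v s) *v x = x)"
    using stoch isometric
  proof (induction t arbitrary: i)
    case 0
    then have *: "P i *v x = x" if "i = j"
      using orth_projection_norm_eq_imp_fixed[OF proj, of i x] that
      unfolding block_proj_product_0 by (simp add: mat_def)
    then show ?case
      unfolding block_proj_product_0 by (auto simp: mat_def)
  next
    case (Suc t)
    let ?q = "\<lambda>k. Q (Suc t) $ i $ k"
    let ?p = "\<lambda>k. left_product Q t $ k $ j"
    let ?B = "\<lambda>k. block (proj_product P Q t) k j *v x"
    let ?y = "\<Sum>k\<in>UNIV. ?q k *\<^sub>R ?B k"
    have stoch': "stochastic (Q s)" if "s \<in> {1..t}" for s
      using Suc.prems that by simp
    have nonneg: "0 \<le> ?q k" for k
      using Suc.prems by (auto simp: stochastic_def)
    have p': "left_product Q (Suc t) $ i $ j = (\<Sum>k\<in>UNIV. ?q k * ?p k)"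
      by (simp add: matrix_matrix_mult_def)
    have "norm (?B k) \<le> ?p k * norm x" for k
      by (rule norm_block_proj_product_le[OF proj stoch'])
    then have term_le: "norm (?q k *\<^sub>R ?B k) \<le> ?q k * (?p k * norm x)" for k
      using nonneg by (auto intro!: mult_left_mono)
    have Py: "norm (P i *v ?y) = (\<Sum>k\<in>UNIV. ?q k * (?p k * norm x))"
      using Suc.prems(2) unfolding block_proj_product_Suc p'
      by (simp add: sum_distrib_right mult.assoc)
    have "norm (P i *v ?y) \<le> norm ?y"
      by (rule orth_projection_norm_le[OF proj])
    moreover have "norm ?y \<le> (\<Sum>k\<in>UNIV. norm (?q k *\<^sub>R ?B k))"
      by (rule norm_sum)
    moreover have "(\<Sum>k\<in>UNIV. norm (?q k *\<^sub>R ?B k)) \<le> (\<Sum>k\<in>UNIV. ?q k * (?p k * norm x))"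
      by (intro sum_mono term_le)
    ultimately have y: "norm (P i *v ?y) = norm ?y"
      and sum_eq: "(\<Sum>k\<in>UNIV. norm (?q k *\<^sub>R ?B k)) = (\<Sum>k\<in>UNIV. ?q k * (?p k * norm x))"
      using Py by linarith+
    have terms_eq: "norm (?q k *\<^sub>R ?B k) = ?q k * (?p k * norm x)" for k
      by (rule sum_mono_inv[OF sum_eq term_le UNIV_I finite])
    have IH: "?B k = ?p k *\<^sub>R x \<and> (\<forall>v s. walk (\<lambda>s. matrix_graph (Q s)) 0 t v \<longrightarrow>
        v 0 = j \<longrightarrow> v t = k \<longrightarrow> s \<le> t \<longrightarrow> P (v s) *v x = x)" if "?q k \<noteq> 0" for k
    proof (rule Suc.IH[OF stoch'])
      show "norm (?B k) = ?p k * norm x"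
        using terms_eq[of k] that nonneg[of k] by simp
    qed
    have "?q k *\<^sub>R ?B k = (?q k * ?p k) *\<^sub>R x" for k
      using IH[of k] by (cases "?q k = 0") auto
    then have y': "?y = left_product Q (Suc t) $ i $ j *\<^sub>R x"
      unfolding p' by (simp add: scaleR_sum_left)
    have Pi: "P i *v ?y = ?y"
      by (rule orth_projection_norm_eq_imp_fixed[OF proj y])
    have "P (v s) *v x = x" if v: "walk (\<lambda>s. matrix_graph (Q s)) 0 (Suc t) v" "v 0 = j"
      "v (Suc t) = i" "s \<le> Suc t" for v s
    proof (cases "s = Suc t")
      case True
      have "left_product Q (Suc t) $ i $ j \<noteq> 0"
        using left_product_walk_pos[OF Suc.prems(1) v(1)] v by simp
      then have "P i *v x = x"
        using Pi unfolding y' by (simp add: matrix_vector_mult_scaleR)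
      then show ?thesis using True v(3) by simp
    next
      case False
      have "walk (\<lambda>s. matrix_graph (Q s)) 0 t v"
        using v(1) by (simp add: walk_def)
      moreover have "?q (v t) \<noteq> 0"
        using v(1,3) by (auto simp: walk_def matrix_graph_def dest!: bspec[of _ _ "Suc t"])
      ultimately show ?thesis
        using IH[of "v t"] v False by simp
    qed
    then show ?case
      using Pi unfolding block_proj_product_Suc y' by blast
  qed
  then show ?thesis
    using walk \<open>s \<le> t\<close> by blast
qed

text \<open>A single block with norm below its weight makes the whole row strict; the block of row \<open>i\<close> at
  the start of the covering walk into \<open>i\<close> is such a block.\<close>

lemma mixed_norm_less_1_if_covering_walks:
  assumes proj: "\<And>i. is_orth_projection_onto (P i) (K i)"
    and stoch: "\<And>s. s \<in> {1..t} \<Longrightarrow> stochastic (Q s)"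
    and trivial: "\<And>x. (\<And>i. P i *v x = x) \<Longrightarrow> x = 0"
    and covering: "\<And>i. \<exists>v. walk (\<lambda>s. matrix_graph (Q s)) 0 t v \<and> v t = i \<and> v ` {0..t} = UNIV"
  shows "mixed_norm (proj_product P Q t) < 1"
  unfolding mixed_norm_less_iff
proof
  fix i
  obtain v where v: "walk (\<lambda>s. matrix_graph (Q s)) 0 t v" "v t = i" "v ` {0..t} = UNIV"
    using covering by blast
  let ?B = "\<lambda>j. block (proj_product P Q t) i j"
  obtain x where x: "norm x = 1" "norm (?B (v 0) *v x) = two_norm (?B (v 0))"
    by (rule two_norm_attained)
  have "two_norm (?B (v 0)) \<noteq> left_product Q t $ i $ v 0"
  proof
    assume "two_norm (?B (v 0)) = left_product Q t $ i $ v 0"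
    then have "norm (?B (v 0) *v x) = left_product Q t $ i $ v 0 * norm x"
      using x by simp
    from isometric_block_fixed[OF proj stoch this v(1) refl v(2)]
    have fixed: "P (v s) *v x = x" if "s \<le> t" for s
      using that by simp
    have "P k *v x = x" for k
    proof -
      have "k \<in> v ` {0..t}" using v(3) by simp
      then show ?thesis using fixed by auto
    qed
    then have "x = 0" by (rule trivial)
    then show False using x(1) by simp
  qed
  moreover have le: "two_norm (?B j) \<le> left_product Q t $ i $ j" for j
    by (rule two_norm_block_proj_product_le[OF proj stoch])
  ultimately have "two_norm (?B (v 0)) < left_product Q t $ i $ v 0"
    by (simp add: order_less_le)
  then have "(\<Sum>j\<in>UNIV. two_norm (?B j)) < (\<Sum>j\<in>UNIV. left_product Q t $ i $ j)"
    using le by (intro sum_strict_mono_ex1) auto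
  also have "\<dots> = 1"
    using stoch by (rule left_product_row_sum)
  finally show "(\<Sum>j\<in>UNIV. two_norm (?B j)) < 1" .
qed

lemma omega_eq_sum: "omega TYPE('m::finite) = \<Sum>{0..CARD('m) - 1}"
  by (simp add: omega_def gauss_sum_nat)

lemma mixed_norm_window_less_1:
  fixes P :: "'m::finite \<Rightarrow> real ^ 'n::finite ^ 'n" and Q :: "nat \<Rightarrow> real ^ 'm ^ 'm"
  defines "N \<equiv> omega TYPE('m)"
  assumes proj: "\<And>i. is_orth_projection_onto (P i) (K i)"
    and stoch: "\<And>s. s \<in> {1..N * l} \<Longrightarrow> stochastic (Q s) \<and> matrix_graph (Q s) \<in> self_arced_graphs"
    and trivial: "\<And>x. (\<And>i. P i *v x = x) \<Longrightarrow> x = 0"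
    and conn: "\<And>k. k < N \<Longrightarrow>
      strongly_connected (with_proj (graph_comp_seq (\<lambda>s. matrix_graph (Q s)) (k * l) l))"
  shows "mixed_norm (proj_product P Q (N * l)) < 1"
proof (rule mixed_norm_less_1_if_covering_walks[OF proj _ trivial])
  fix i
  let ?G = "\<lambda>s. matrix_graph (Q s)"
  have "\<exists>v. walk ?G (0 * l) ((0 + \<Sum>{0..CARD('m) - 1}) * l) v \<and>
      v ((0 + \<Sum>{0..CARD('m) - 1}) * l) = i \<and>
      CARD('m) - 1 < card (v ` {0 * l..(0 + \<Sum>{0..CARD('m) - 1}) * l})"
    by (rule covering_walk[where N = N])
      (use stoch conn in \<open>auto simp: N_def omega_eq_sum self_arced_graphs_def\<close>)
  then obtain v where v: "walk ?G 0 (N * l) v" "v (N * l) = i" "CARD('m) - 1 < card (v ` {0..N * l})"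
    by (auto simp: N_def omega_eq_sum)
  then have "v ` {0..N * l} = UNIV"
    by (intro card_seteq) (simp_all add: Suc_le_eq)
  then show "\<exists>v. walk ?G 0 (N * l) v \<and> v (N * l) = i \<and> v ` {0..N * l} = UNIV"
    using v by blast
qed (use stoch in auto)

section \<open>Uniform contraction by compactness\<close>

lemma window_position_div_less:
  fixes s N l :: nat
  assumes "s \<in> {1..N * l}"
  shows "(s - 1) div l < N"
  using assms by (intro less_mult_imp_div_less) auto

lemma tendsto_matrix_mult:
  fixes A :: "real ^ 'k ^ 'm" and B :: "real ^ 'n ^ 'k"
  assumes "(f \<longlongrightarrow> A) F" "(g \<longlongrightarrow> B) F"
  shows "((\<lambda>x. f x ** g x) \<longlongrightarrow> A ** B) F"
  unfolding matrix_matrix_mult_def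
  by (intro vec_tendstoI) (auto intro!: tendsto_intros assms)

lemma tendsto_proj_product:
  assumes "\<And>s. s \<in> {1..t} \<Longrightarrow> ((\<lambda>x. Q x s) \<longlongrightarrow> R s) F"
  shows "((\<lambda>x. proj_product P (Q x) t) \<longlongrightarrow> proj_product P R t) F"
  using assms
proof (induction t)
  case (Suc t)
  have "((\<lambda>x. Q x (Suc t) \<otimes>\<^sub>K mat 1) \<longlongrightarrow> R (Suc t) \<otimes>\<^sub>K mat 1) F"
    unfolding kron_def using Suc.prems
    by (intro vec_tendstoI) (auto intro!: tendsto_intros)
  then show ?case
    using Suc by (auto intro!: tendsto_matrix_mult)
qed simp

lemma tendsto_block:
  assumes "(f \<longlongrightarrow> Q) F"
  shows "((\<lambda>x. block (f x) i j) \<longlongrightarrow> block Q i j) F"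
  unfolding block_def by (intro vec_tendstoI) (auto intro!: tendsto_intros assms)

lemma compactin_attains_sup:
  assumes "compactin X K" "K \<noteq> {}" "continuous_map X euclideanreal f"
  obtains x where "x \<in> K" "\<And>y. y \<in> K \<Longrightarrow> f y \<le> f x"
  using compact_attains_sup[of "f ` K"] image_compactin[OF assms(1,3)] assms(2) by auto

text \<open>Lists of length \<open>N\<close> over \<open>X\<close> are represented by extensional functions on \<open>{..<N}\<close>, which form
  a compact set in the product topology.  Each row sum of block norms is continuous there and
  attains its maximum, which is less than 1; the bound is the largest of these finitely many
  maxima.\<close>

lemma uniform_contraction:
  fixes P :: "'m::finite \<Rightarrow> real ^ 'n::finite ^ 'n" and X :: "(nat \<Rightarrow> real ^ 'm ^ 'm) set"
  assumes "compactin (product_topology (\<lambda>_. euclidean) {1..l}) X" "X \<noteq> {}"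
    and less: "\<And>hs. set hs \<subseteq> X \<Longrightarrow> length hs = N \<Longrightarrow>
      mixed_norm (proj_product P (join_sequences l hs) (N * l)) < 1"
  obtains c where "c < 1" "\<And>hs. set hs \<subseteq> X \<Longrightarrow> length hs = N \<Longrightarrow>
      mixed_norm (proj_product P (join_sequences l hs) (N * l)) \<le> c"
proof -
  define T where "T = product_topology (\<lambda>_::nat. product_topology (\<lambda>_. euclidean) {1..l} ::
    (nat \<Rightarrow> real ^ 'm ^ 'm) topology) {..<N}"
  define K where "K = ({..<N} \<rightarrow>\<^sub>E X)"
  define q where "q = (\<lambda>(g :: nat \<Rightarrow> nat \<Rightarrow> real ^ 'm ^ 'm) s. g ((s - 1) div l) ((s - 1) mod l + 1))"
  define f where "f = (\<lambda>i g. \<Sum>j\<in>UNIV. two_norm (block (proj_product P (q g) (N * l)) i j))"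
  have join: "proj_product P (join_sequences l (map g [0..<N])) (N * l) = proj_product P (q g) (N * l)"
    for g
  proof (rule proj_product_cong)
    fix s assume "s \<in> {1..N * l}"
    then have "(s - 1) div l < N"
      by (rule window_position_div_less)
    then show "join_sequences l (map g [0..<N]) s = q g s"
      by (simp add: join_sequences_def q_def)
  qed
  have f_less: "f i g < 1" if "g \<in> K" for i g
  proof -
    have "g b \<in> X" if "b < N" for b
      using PiE_mem[OF \<open>g \<in> K\<close>[unfolded K_def], of b] that by simp
    then have "set (map g [0..<N]) \<subseteq> X"
      by (simp add: image_subset_iff)
    then have "mixed_norm (proj_product P (join_sequences l (map g [0..<N])) (N * l)) < 1"
      by (rule less) simp
    then show ?thesis
      unfolding join mixed_norm_less_iff f_def by (rule spec)
  qed
  have cont: "continuous_map T euclideanreal (f i)" for i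
    unfolding continuous_map_atin limitin_canonical_iff
  proof
    fix g assume g: "g \<in> topspace T"
    have coord: "((\<lambda>h. q h s) \<longlongrightarrow> q g s) (atin T g)" if "s \<in> {1..N * l}" for s
    proof -
      have "l > 0" using that by (cases l) auto
      have "(s - 1) div l \<in> {..<N}"
        using window_position_div_less[OF that] by simp
      then have "continuous_map T (product_topology (\<lambda>_. euclidean) {1..l}) (\<lambda>h. h ((s - 1) div l))"
        unfolding T_def by (rule continuous_map_product_projection)
      moreover have "(s - 1) mod l + 1 \<in> {1..l}"
        using \<open>l > 0\<close> by (simp add: Suc_le_eq)
      then have "continuous_map (product_topology (\<lambda>_. euclidean) {1..l}) euclidean
          (\<lambda>h :: nat \<Rightarrow> real ^ 'm ^ 'm. h ((s - 1) mod l + 1))"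
        by (rule continuous_map_product_projection)
      ultimately have "continuous_map T euclidean (\<lambda>h. q h s)"
        unfolding q_def by (rule continuous_map_compose[unfolded o_def])
      then show ?thesis
        using g by (simp add: continuous_map_atin)
    qed
    show "(f i \<longlongrightarrow> f i g) (atin T g)"
      unfolding f_def by (intro tendsto_intros tendsto_block tendsto_proj_product coord)
  qed
  have "compactin T K"
    unfolding T_def K_def using assms(1) by (simp add: compactin_PiE)
  moreover have "K \<noteq> {}"
    using assms(2) by (simp add: K_def PiE_eq_empty_iff)
  ultimately have "\<exists>g\<in>K. \<forall>h\<in>K. f i h \<le> f i g" for i
    using compactin_attains_sup[OF _ _ cont] by metis
  then obtain m where m: "\<And>i. m i \<in> K" "\<And>i h. h \<in> K \<Longrightarrow> f i h \<le> f i (m i)"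
    by metis
  define c where "c = (MAX i. f i (m i))"
  have c_ge: "f i h \<le> c" if "h \<in> K" for i h
    using m(2)[OF that, of i] by (rule order_trans) (simp add: c_def)
  show thesis
  proof (rule that)
    show "c < 1"
      unfolding c_def using f_less m(1) by (subst Max_less_iff) auto
  next
    fix hs assume hs: "set hs \<subseteq> X" "length hs = N"
    define g where "g = (\<lambda>b\<in>{..<N}. hs ! b)"
    have "g \<in> K"
      using hs by (auto simp: g_def K_def)
    moreover have "hs = map g [0..<N]"
      using hs(2) by (intro nth_equalityI) (auto simp: g_def)
    ultimately show "mixed_norm (proj_product P (join_sequences l hs) (N * l)) \<le> c"
      using join[of g] c_ge by (simp add: f_def mixed_norm_le_iff)
  qed
qed

section \<open>Iterated suprema\<close>

lemma iterated_sup_le: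
  assumes "X \<noteq> {}" "\<And>hs. set hs \<subseteq> X \<Longrightarrow> length hs = k \<Longrightarrow> F hs \<le> c"
  shows "iterated_sup X k F \<le> c"
  using assms(2)
proof (induction k arbitrary: F)
  case (Suc k)
  show ?case
    unfolding iterated_sup.simps
    by (intro cSUP_least assms(1) Suc.IH Suc.prems) auto
qed simp

text \<open>The upper bound \<open>c\<close> makes the real suprema genuine at every level.\<close>

lemma le_iterated_sup:
  assumes "\<And>hs. set hs \<subseteq> X \<Longrightarrow> length hs = k \<Longrightarrow> F hs \<le> c"
    and "set hs \<subseteq> X" "length hs = k"
  shows "F hs \<le> iterated_sup X k F"
  using assms
proof (induction k arbitrary: F hs)
  case (Suc k)
  obtain hs' h where hs: "hs = hs' @ [h]"
    using Suc.prems(3) by (metis length_Suc_conv_rev)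
  then have h: "h \<in> X" "set hs' \<subseteq> X" "length hs' = k"
    using Suc.prems by auto
  have "F hs \<le> iterated_sup X k (\<lambda>hs. F (hs @ [h]))"
    unfolding hs by (rule Suc.IH[of "\<lambda>hs. F (hs @ [h])"]) (use h Suc.prems(1) in auto)
  also have "\<dots> \<le> iterated_sup X (Suc k) F"
    unfolding iterated_sup.simps
  proof (rule cSUP_upper[OF h(1)])
    show "bdd_above ((\<lambda>h. iterated_sup X k (\<lambda>hs. F (hs @ [h]))) ` X)"
      using h(1) Suc.prems(1) by (intro bdd_aboveI2[of _ _ c] iterated_sup_le) auto
  qed
  finally show ?case .
qed simp

section \<open>The convergence rate\<close>

text \<open>With \<open>x = L powr (1 / N)\<close> the left-hand side is \<open>x ^ (N * (t div N))\<close>, and rounding \<open>t\<close> down to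
  a multiple of \<open>N\<close> loses less than \<open>N\<close>.  For \<open>L = 0\<close> this is a matter of conventions: the right-hand
  side is infinite for \<open>t < N\<close>, and the left-hand side is 0 for \<open>t \<ge> N\<close>.\<close>

lemma power_div_le_ext_power:
  assumes "0 \<le> L" "L < 1" "N > 0"
  shows "ereal (L ^ (t div N)) \<le> ext_power (L powr (1 / real N)) (int t - int N)"
proof (cases "L = 0")
  case True
  have "L ^ (t div N) \<le> (0 :: real) powi (int t - int N)" if "t \<ge> N"
  proof -
    have "t div N \<noteq> 0"
      using that assms(3) by (simp add: div_eq_0_iff)
    then show ?thesis
      using that True by (simp add: power_int_def power_0_left)
  qed
  then show ?thesis
    using True by (auto simp: ext_power_def)
next
  case False
  define x where "x = L powr (1 / real N)"
  have x: "0 < x" "x < 1"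
    using False assms powr_less_mono2[of "1 / real N" L 1] by (auto simp: x_def)
  have "x powr real N = L"
    using False assms by (simp add: x_def powr_powr)
  then have "L ^ (t div N) = x ^ (N * (t div N))"
    using x by (simp add: power_mult powr_realpow)
  also have "\<dots> = x powi int (N * (t div N))"
    by (simp add: power_int_of_nat del: of_nat_mult)
  also have "\<dots> \<le> x powi (int t - int N)"
  proof (rule power_int_decreasing)
    have "t = N * (t div N) + t mod N" "t mod N < N"
      using assms(3) by simp_all
    then have "t \<le> N * (t div N) + N" by linarith
    then show "int t - int N \<le> int (N * (t div N))" by linarith
  qed (use x in auto)
  finally show ?thesis
    using x by (simp add: ext_power_def x_def[symmetric])
qed

lemma mixed_norm_windows_le_power:
  assumes proj: "\<And>i. is_orth_projection_onto (P i) (K i)" "\<And>i. subspace (K i)"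
    and stoch: "\<And>s. s \<ge> 1 \<Longrightarrow> stochastic (S s)"
    and window: "\<And>k. mixed_norm (proj_product P (\<lambda>s. S (k * N + s)) N) \<le> L"
  shows "mixed_norm (proj_product P S (k * N + r)) \<le> L ^ k"
  using stoch window
proof (induction k arbitrary: S)
  case 0
  have "mixed_norm (proj_product P S (0 * N + r)) \<le> 1"
    by (rule mixed_norm_proj_product_le_1[OF proj(1)]) (use 0 in auto)
  then show ?case by simp
next
  case (Suc k)
  have "0 \<le> L"
    using Suc.prems(2)[of 0] mixed_norm_ge_0 order_trans by blast
  have "proj_product P S (Suc k * N + r) =
      proj_product P (\<lambda>s. S (N + s)) (k * N + r) ** proj_product P S N"
    using proj_product_add[of P S N "k * N + r"] orth_projection_idempotent[OF proj]
    by (simp add: add.assoc)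
  then have "mixed_norm (proj_product P S (Suc k * N + r)) \<le>
      mixed_norm (proj_product P (\<lambda>s. S (N + s)) (k * N + r)) * mixed_norm (proj_product P S N)"
    by (simp add: mixed_norm_mult)
  also have "\<dots> \<le> L ^ k * L"
  proof (rule mult_mono)
    show "mixed_norm (proj_product P (\<lambda>s. S (N + s)) (k * N + r)) \<le> L ^ k"
    proof (rule Suc.IH)
      fix k
      show "mixed_norm (proj_product P (\<lambda>s. S (N + (k * N + s))) N) \<le> L"
        using Suc.prems(2)[of "Suc k"] by (simp add: add.assoc)
    qed (use Suc.prems in auto)
    show "mixed_norm (proj_product P S N) \<le> L"
      using Suc.prems(2)[of 0] by simp
  qed (use \<open>0 \<le> L\<close> mixed_norm_ge_0 in auto)
  finally show ?case by (simp add: mult.commute)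
qed

lemma strongly_connected_left_product:
  assumes "\<And>s. s \<in> {1..l} \<Longrightarrow> stochastic (h s)"
    and "\<And>s. s \<in> {1..l} \<Longrightarrow> h s = Q (a + s)"
  shows "strongly_connected (with_proj (matrix_graph (left_product h l))) \<longleftrightarrow>
    strongly_connected (with_proj (graph_comp_seq (\<lambda>s. matrix_graph (Q s)) a l))"
proof -
  have "left_product h l = left_product (\<lambda>s. Q (a + s)) l"
    using assms(2) by (rule left_product_cong)
  moreover have "matrix_graph (left_product (\<lambda>s. Q (a + s)) l) =
      graph_comp_seq (\<lambda>s. matrix_graph (Q (a + s))) 0 l"
    using assms by (intro matrix_graph_left_product) metis
  ultimately show ?thesis
    using graph_comp_seq_shift[of "\<lambda>s. matrix_graph (Q s)" a 0 l] by simp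
qed

theorem theorem3:
  fixes A :: "'m::finite \<Rightarrow> (real ^ 'n::finite) list"
    and P :: "'m \<Rightarrow> real ^ 'n ^ 'n"
    and C :: "(real ^ 'm ^ 'm) set"
    and l :: nat
  assumes "CARD('m) > 1"
    and "\<And>i. is_orth_projection_onto (P i) (rows_kernel (A i))"
    and "(\<Inter>i. column_span (P i)) = {0}"
    and "l > 0"
    and "l_compact l C"
  shows "conv_rate P l C < 1 \<and>
    (\<forall>S :: nat \<Rightarrow> real ^ 'm ^ 'm.
       (\<forall>t\<ge>1. S t \<in> C) \<and>
       rep_jointly_strongly_connected l (\<lambda>t. matrix_graph (S t)) \<longrightarrow>
       (\<forall>t\<ge>1. ereal (mixed_norm (proj_product P S t))
               \<le> ext_power (conv_rate P l C) (int t - int (l * omega TYPE('m)))))"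
proof -
  define N where "N = omega TYPE('m)"
  define X where "X = sc_sequences C l"
  define F where "F = (\<lambda>hs. mixed_norm (proj_product P (join_sequences l hs) (N * l)))"
  define L where "L = iterated_sup X N F"
  note proj = assms(2)
  have C: "stochastic M \<and> matrix_graph M \<in> self_arced_graphs" if "M \<in> C" for M
    using assms(5) that by (auto simp: l_compact_def)
  have X: "X \<noteq> {}" "compactin (product_topology (\<lambda>_. euclidean) {1..l}) X"
    using assms(5) by (auto simp: l_compact_def X_def)
  have XD: "h s \<in> C" "strongly_connected (with_proj (matrix_graph (left_product h l)))"
    if "h \<in> X" "s \<in> {1..l}" for h s
    using that by (auto simp: X_def sc_sequences_def)
  have trivial: "x = 0" if "\<And>i. P i *v x = x" for x
  proof -
    have "x \<in> column_span (P i)" for i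
      using that[of i] matrix_vector_mult_in_columnspace[of "P i" x] by (simp add: column_span_def)
    then show ?thesis using assms(3) by blast
  qed
  have "2 * 1 \<le> CARD('m) * (CARD('m) - 1)"
    using assms(1) by (intro mult_le_mono) auto
  then have "N > 0"
    using assms(1) by (simp add: N_def omega_def mult.commute div_greater_zero_iff)
  have F_less: "F hs < 1" if hs: "set hs \<subseteq> X" "length hs = N" for hs
    unfolding F_def N_def
  proof (rule mixed_norm_window_less_1[OF proj _ trivial])
    let ?Q = "join_sequences l hs"
    fix s assume "s \<in> {1..omega TYPE('m) * l}"
    then have "(s - 1) div l < N"
      unfolding N_def by (rule window_position_div_less)
    then have "hs ! ((s - 1) div l) \<in> X"
      using hs by (metis nth_mem subsetD)
    moreover have "(s - 1) mod l + 1 \<in> {1..l}"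
      using assms(4) by (simp add: Suc_le_eq)
    ultimately have "?Q s \<in> C"
      unfolding join_sequences_def by (rule XD(1))
    then show "stochastic (?Q s) \<and> matrix_graph (?Q s) \<in> self_arced_graphs"
      by (rule C)
  next
    let ?Q = "join_sequences l hs"
    fix k assume "k < omega TYPE('m)"
    then have k: "hs ! k \<in> X"
      using hs by (metis N_def nth_mem subsetD)
    have "(hs ! k) s = ?Q (k * l + s)" if "s \<in> {1..l}" for s
    proof -
      have shift: "k * l + s - 1 = (s - 1) + k * l" and "s - 1 < l"
        using that by auto
      have "(k * l + s - 1) div l = k" "(k * l + s - 1) mod l = s - 1"
        unfolding shift using \<open>s - 1 < l\<close> by simp_all
      moreover have "s - 1 + 1 = s"
        using that by simp
      ultimately show ?thesis
        by (simp only: join_sequences_def)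
    qed
    moreover have "stochastic ((hs ! k) s)" if "s \<in> {1..l}" for s
      using C XD(1)[OF k that] by blast
    ultimately show "strongly_connected (with_proj (graph_comp_seq (\<lambda>s. matrix_graph (?Q s)) (k * l) l))"
      using strongly_connected_left_product[of l "hs ! k" ?Q "k * l"] XD(2)[OF k, of l] assms(4)
      by simp
  qed
  obtain c where c: "c < 1" "\<And>hs. set hs \<subseteq> X \<Longrightarrow> length hs = N \<Longrightarrow> F hs \<le> c"
    using uniform_contraction[OF X(2,1) F_less[unfolded F_def]] unfolding F_def by metis
  have "L < 1"
    using iterated_sup_le[OF X(1) c(2)] c(1) unfolding L_def by (rule le_less_trans)
  have F_le: "F hs \<le> L" if "set hs \<subseteq> X" "length hs = N" for hs
    unfolding L_def by (rule le_iterated_sup[OF c(2) that])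
  obtain h where "h \<in> X" using X(1) by blast
  then have "F (replicate N h) \<le> L"
    by (intro F_le) auto
  then have "0 \<le> L"
    using mixed_norm_ge_0 order_trans unfolding F_def by blast
  have rate: "conv_rate P l C = L powr (1 / real (N * l))"
    by (simp add: conv_rate_def L_def F_def X_def N_def)
  have "conv_rate P l C < 1"
    unfolding rate using \<open>0 \<le> L\<close> \<open>L < 1\<close> \<open>N > 0\<close> assms(4)
    by (cases "L = 0") (use powr_less_mono2[of "1 / real (N * l)" L 1] in auto)
  moreover have "ereal (mixed_norm (proj_product P S t)) \<le>
      ext_power (conv_rate P l C) (int t - int (l * omega TYPE('m)))"
    if S: "\<forall>t\<ge>1. S t \<in> C" "rep_jointly_strongly_connected l (\<lambda>t. matrix_graph (S t))"
    for S :: "nat \<Rightarrow> real ^ 'm ^ 'm" and t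
  proof -
    have window: "mixed_norm (proj_product P (\<lambda>s. S (k * (N * l) + s)) (N * l)) \<le> L" for k
    proof -
      define blk where "blk = (\<lambda>b. \<lambda>s\<in>{1..l}. S ((k * N + b) * l + s))"
      have "blk b \<in> X" for b
      proof -
        have "blk b \<in> {1..l} \<rightarrow>\<^sub>E C"
          using S(1) by (auto simp: blk_def)
        moreover have "strongly_connected (with_proj (matrix_graph (left_product (blk b) l)))"
          using strongly_connected_left_product[of l "blk b" S "(k * N + b) * l"] S C
          by (auto simp: blk_def rep_jointly_strongly_connected_def)
        ultimately show ?thesis by (simp add: X_def sc_sequences_def)
      qed
      then have "F (map blk [0..<N]) \<le> L"
        by (intro F_le) auto
      moreover have "proj_product P (join_sequences l (map blk [0..<N])) (N * l) =
          proj_product P (\<lambda>s. S (k * (N * l) + s)) (N * l)"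
      proof (rule proj_product_cong)
        fix s assume s: "s \<in> {1..N * l}"
        let ?b = "(s - 1) div l" and ?r = "(s - 1) mod l"
        have "?b < N" "?r < l"
          using window_position_div_less[OF s] assms(4) by simp_all
        moreover have "?b * l + (?r + 1) = s"
          using s by simp
        then have "(k * N + ?b) * l + (?r + 1) = k * (N * l) + s"
          by (simp add: algebra_simps)
        ultimately show "join_sequences l (map blk [0..<N]) s = S (k * (N * l) + s)"
          by (simp add: join_sequences_def blk_def)
      qed
      ultimately show ?thesis by (simp add: F_def)
    qed
    have "mixed_norm (proj_product P S (t div (N * l) * (N * l) + t mod (N * l))) \<le> L ^ (t div (N * l))"
      using S(1) C by (intro mixed_norm_windows_le_power[OF proj subspace_rows_kernel _ window]) auto
    then have "ereal (mixed_norm (proj_product P S t)) \<le> ereal (L ^ (t div (N * l)))"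
      unfolding div_mult_mod_eq by simp
    also have "\<dots> \<le> ext_power (conv_rate P l C) (int t - int (N * l))"
      unfolding rate using \<open>0 \<le> L\<close> \<open>L < 1\<close> \<open>N > 0\<close> assms(4) by (intro power_div_le_ext_power) auto
    finally show ?thesis
      by (simp add: N_def mult.commute)
  qed
  ultimately show ?thesis by blast
qed

end
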